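(* Let $t_1,t_2,\dots$ be independent parameters and define $x_k(z)\in\mathbb Q[z,t_1,\dots,t_k]$ by $x_0=1$ and, for $k\ge1$, $$x_k(z)= \frac{1}{k!}\begin{vmatrix} z_1 & -1 & 0 & \cdots & 0 \\ z_2 & z_1 & -2 & \cdots & 0 \\ \vdots & \vdots & \ddots & \ddots & \vdots \\ z_{k-1} & z_{k-2} & \cdots & z_1 & -(k-1) \\ z_k & z_{k-1} & \cdots & z_2 & z_1 \end{vmatrix},\qquad z_i=(-1)^{i+1}(z+t_i).$$ Put $x_j=0$ for $j<0$, and define $Q_{-1}(z)=Q_0(z)=1$ and, for $k\ge 1$, $$Q_k(z)=\det\big(x_{2j-i}(z)\big)_{i,j=1}^{k}.$$ Then for all $n\ge 0$ $$Q_{n+1}(z+1)Q_{n-1}(z)-Q_{n+1}(z)Q_{n-1}(z+1)=Q_n(z)Q_n(z+1).$$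
   Context: Equivalently, the $x_k$ are given by the generating function $\sum_{k\ge0}x_k(z)u^k=\exp\big(\sum_{k\ge1}(-1)^{k+1}(z+t_k)\frac{u^k}{k}\big)$ and satisfy $x_k(z+1)-x_k(z)=x_{k-1}(z)$. The determinant $Q_k$ (whose first row is $x_1,x_3,\dots,x_{2k-1}$, second row $1,x_2,x_4,\dots,x_{2k-2}$, third row $0,x_1,x_3,\dots$, etc.) equals the Casoratian $C(x_1,x_3,\dots,x_{2k-1})$, where $C(f_1,\dots,f_k)=\det\big(f_i(z+j-1)\big)_{i,j=1}^k$. The shift $z\mapsto z+1$ keeps all $t_j$ fixed. *)

theory Defs
  imports
    "HOL-Library.Poly_Mapping"
    "HOL-Computational_Algebra.Polynomial"
    "Jordan_Normal_Form.Determinant"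
begin

text \<open>
  The ring \<open>\<rat>[t\<^sub>1, t\<^sub>2, \<dots>]\<close> consists of the finitely supported maps from exponent vectors
  to rational coefficients. Index \<open>0\<close> is an additional variable that is never used below.
  Polynomials in \<open>z\<close> over this ring are of type \<^typ>\<open>((nat \<Rightarrow>\<^sub>0 nat) \<Rightarrow>\<^sub>0 rat) poly\<close>, so that
  the \<open>t\<^sub>i\<close> are independent indeterminates that do not depend on \<open>z\<close>.
\<close>

type_synonym params = "(nat \<Rightarrow>\<^sub>0 nat) \<Rightarrow>\<^sub>0 rat"

definition t_var :: "nat \<Rightarrow> params" where
  "t_var i = Poly_Mapping.single (Poly_Mapping.single i 1) 1"

definition const :: "rat \<Rightarrow> params" where
  "const q = Poly_Mapping.single 0 q"

definition zi :: "nat \<Rightarrow> params poly" where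
  "zi i = (-1) ^ (i + 1) * ([:0, 1:] + [:t_var i:])"

text \<open>
  Matrix indices start at \<open>0\<close>, so the superdiagonal entry in position \<open>(i, i + 1)\<close> is \<open>-(i + 1)\<close>.
\<close>

definition x_mat :: "nat \<Rightarrow> params poly mat" where
  "x_mat k = mat k k (\<lambda>(i, j).
     if j \<le> i then zi (i - j + 1)
     else if j = i + 1 then - of_nat (i + 1)
     else 0)"

definition x_poly :: "int \<Rightarrow> params poly" where
  "x_poly k = (if k < 0 then 0
          else if k = 0 then 1
          else smult (const (1 / fact (nat k))) (det (x_mat (nat k))))"

text \<open>
  The shift of the column and row indices by \<open>1\<close> again accounts for matrix indices starting at \<open>0\<close>.
  Only the values of \<open>Q_poly\<close> at \<open>k \<ge> -1\<close> are meaningful.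
\<close>

definition Q_poly :: "int \<Rightarrow> params poly" where
  "Q_poly k = (if k \<le> 0 then 1
          else det (mat (nat k) (nat k) (\<lambda>(i, j). x_poly (2 * (int j + 1) - (int i + 1)))))"

text \<open>The substitution \<open>z \<mapsto> z + 1\<close>, which fixes all \<open>t\<^sub>i\<close>.\<close>

definition shift :: "params poly \<Rightarrow> params poly" where
  "shift p = pcompose p [:1, 1:]"

end

theory Submission
  imports Defs
begin

text \<open>
  Let \<open>E\<close> be the shift \<open>z \<mapsto> z + 1\<close> and \<open>\<Delta> = E - 1\<close>. Expanding the Hessenberg determinant along
  its last row gives \<open>k x\<^sub>k = z\<^sub>k x\<^sub>0 + \<dots> + z\<^sub>1 x\<^bsub>k-1\<^esub>\<close>, from which \<open>\<Delta> x\<^sub>k = x\<^bsub>k-1\<^esub>\<close> follows by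
  induction. Hence \<open>Q\<^sub>k\<close> is the determinant of the rows \<open>1, \<Delta>, \<dots>, \<Delta>\<^bsup>k-1\<^esup>\<close> applied to
  \<open>x\<^sub>1, x\<^sub>3, \<dots>, x\<^bsub>2k-1\<^esub>\<close>; and since \<open>\<Delta> x\<^sub>1 = 1\<close> and \<open>\<Delta>\<^sup>2 x\<^bsub>2j+1\<^esub> = x\<^bsub>2j-1\<^esub>\<close>, the rows
  \<open>\<Delta>, \<dots>, \<Delta>\<^bsup>k+1\<^esup>\<close> applied to \<open>x\<^sub>1, \<dots>, x\<^bsub>2k+1\<^esub>\<close> also have determinant \<open>Q\<^sub>k\<close>.
  The identity is the three-term Pluecker relation for the rows \<open>E\<close>, \<open>\<Delta>\<close>, \<open>E \<Delta>\<^sup>n\<close> and the linear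
  form \<open>x \<mapsto> det(x, E \<Delta>, \<dots>, E \<Delta>\<^bsup>n-1\<^esup>)\<close> on the first \<open>n\<close> columns, modulo the rows
  \<open>E \<Delta>, \<dots>, E \<Delta>\<^bsup>n-1\<^esup>\<close>: up to unimodular row operations, the six minors are \<open>Q\<^bsub>n-1\<^esub>\<close>, \<open>Q\<^sub>n\<close>,
  \<open>Q\<^bsub>n+1\<^esub>\<close> and their shifts.
\<close>

section \<open>Determinants of leading blocks and a Pluecker relation\<close>

definition fdet :: "nat \<Rightarrow> (nat \<Rightarrow> nat \<Rightarrow> 'a) \<Rightarrow> 'a::comm_ring_1" where
  "fdet n f = det (mat n n (\<lambda>(i, j). f i j))"

lemma fdet_cong:
  assumes "\<And>i j. i < n \<Longrightarrow> j < n \<Longrightarrow> f i j = g i j"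
  shows "fdet n f = fdet n g"
  unfolding fdet_def by (rule arg_cong[where f = det]) (auto simp: assms)

lemma fdet_0 [simp]: "fdet 0 f = 1"
  by (simp add: fdet_def)

lemma (in comm_ring_hom) hom_fdet: "hom (fdet n f) = fdet n (\<lambda>i j. hom (f i j))"
proof -
  have "map_mat hom (mat n n (\<lambda>(i, j). f i j)) = mat n n (\<lambda>(i, j). hom (f i j))"
    by (intro eq_matI) auto
  then show ?thesis unfolding fdet_def by (metis hom_det)
qed

lemma mat_delete_mat:
  assumes "i < Suc n" "j < Suc n"
  shows "mat_delete (mat (Suc n) (Suc n) (\<lambda>(a, b). f a b)) i j
    = mat n n (\<lambda>(a, b). f (insert_index i a) (insert_index j b))"
  using assms by (intro eq_matI) (auto simp: mat_delete_def insert_index_def)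

lemma fdet_expand_row:
  assumes "i < Suc n"
  shows "fdet (Suc n) f = (\<Sum>j<Suc n. (-1) ^ (i + j) * f i j *
           fdet n (\<lambda>a b. f (insert_index i a) (insert_index j b)))"
  unfolding fdet_def using assms
  by (subst laplace_expansion_row[of _ "Suc n" i])
    (auto simp: cofactor_def mat_delete_mat ac_simps simp del: sum.lessThan_Suc intro!: sum.cong)

lemma fdet_expand_column:
  assumes "j < Suc n"
  shows "fdet (Suc n) f = (\<Sum>i<Suc n. (-1) ^ (i + j) * f i j *
           fdet n (\<lambda>a b. f (insert_index i a) (insert_index j b)))"
  unfolding fdet_def using assms
  by (subst laplace_expansion_column[of _ "Suc n" j])
    (auto simp: cofactor_def mat_delete_mat ac_simps simp del: sum.lessThan_Suc intro!: sum.cong)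

lemma fdet_equal_rows:
  assumes "a \<noteq> b" "a < n" "b < n" "\<And>j. j < n \<Longrightarrow> f a j = f b j"
  shows "fdet n f = 0"
  unfolding fdet_def
  by (rule det_identical_rows[of _ n a b]) (use assms in \<open>auto intro!: eq_vecI\<close>)

lemma fdet_equal_columns:
  assumes "a \<noteq> b" "a < n" "b < n" "\<And>i. i < n \<Longrightarrow> f i a = f i b"
  shows "fdet n f = 0"
  unfolding fdet_def
  by (rule det_identical_columns[of _ n a b]) (use assms in \<open>auto intro!: eq_vecI\<close>)

text \<open>Left multiplication by a unit lower bidiagonal matrix. Since \<open>0 - 1 = 0\<close> on
  naturals, \<open>c 0 = 0\<close> keeps row 0 from being rescaled.\<close>

lemma fdet_add_previous_rows:
  assumes "c 0 = 0"
  shows "fdet n (\<lambda>i j. f i j + c i * f (i - 1) j) = fdet n f"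
proof -
  define L where "L = mat n n (\<lambda>(i, k). if k = i then 1 else if Suc k = i then c i else 0)"
  let ?F = "mat n n (\<lambda>(i, j). f i j)"
  have "mat n n (\<lambda>(i, j). f i j + c i * f (i - 1) j) = L * ?F"
  proof (rule eq_matI; clarsimp simp: L_def scalar_prod_def)
    fix i j assume "i < n" "j < n"
    have "(\<Sum>k = 0..<n. (if k = i then 1 else if Suc k = i then c i else 0) * f k j)
        = (\<Sum>k = 0..<n. (if k = i then f k j else 0) + (if Suc k = i then c i * f k j else 0))"
      by (intro sum.cong) auto
    also have "\<dots> = f i j + (\<Sum>k = 0..<n. if Suc k = i then c i * f k j else 0)"
      using \<open>i < n\<close> by (simp add: sum.distrib)
    also have "(\<Sum>k = 0..<n. if Suc k = i then c i * f k j else 0) = c i * f (i - 1) j"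
      using \<open>i < n\<close> assms by (cases i) auto
    finally show "f i j + c i * f (i - Suc 0) j
        = (\<Sum>k = 0..<n. (if k = i then 1 else if Suc k = i then c i else 0) * f k j)"
      by simp
  qed
  moreover have "det L = 1"
    by (subst det_lower_triangular[of n]) (auto simp: L_def prod_list_diag_prod)
  ultimately show ?thesis
    unfolding fdet_def by (subst det_mult[of _ n, symmetric] | simp add: L_def det_mult[of _ n])+
qed

lemma fdet_add_row:
  assumes "a \<noteq> b" "b < n"
  shows "fdet n (\<lambda>i j. if i = a then f b j + f i j else f i j) = fdet n f"
proof -
  have "mat n n (\<lambda>(i, j). if i = a then f b j + f i j else f i j)
      = addrow 1 a b (mat n n (\<lambda>(i, j). f i j))"
    using assms by (intro eq_matI) auto
  then show ?thesis
    unfolding fdet_def using assms by (simp add: det_addrow[of b n])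
qed

text \<open>Expands a determinant with a repeated column along that column.\<close>
lemma sum_minors_eq_0:
  assumes "j < n"
  shows "(\<Sum>k<Suc n. (-1) ^ k * fdet n (\<lambda>i. v (insert_index k i)) * v k j) = 0"
proof -
  let ?f = "\<lambda>i l. if l = n then v i j else v i l"
  have "0 = fdet (Suc n) ?f"
    using assms by (intro fdet_equal_columns[symmetric, of j n]) auto
  also have "\<dots> = (\<Sum>k<Suc n. (-1) ^ (k + n) * v k j * fdet n (\<lambda>i. v (insert_index k i)))"
    unfolding fdet_expand_column[OF lessI]
    by (intro sum.cong refl arg_cong2[where f = "(*)"] fdet_cong) (auto simp: insert_index_def)
  also have "\<dots> = (-1) ^ n * (\<Sum>k<Suc n. (-1) ^ k * fdet n (\<lambda>i. v (insert_index k i)) * v k j)"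
    unfolding sum_distrib_left by (intro sum.cong) (auto simp: power_add ac_simps)
  finally show ?thesis
    by (cases "even n") (auto simp del: sum.lessThan_Suc)
qed

text \<open>Expanded along row 0, the second factor is a linear form in \<open>v k\<close> whose
  coefficients do not depend on \<open>k\<close>; it involves only columns below \<open>n\<close>,
  and for each of these \<open>sum_minors_eq_0\<close> applies.\<close>

lemma pluecker:
  assumes "m < n"
  shows "(\<Sum>k<Suc n. (-1) ^ k * fdet n (\<lambda>i. v (insert_index k i)) *
           fdet (Suc m) (\<lambda>i. if i = 0 then v k else w i)) = 0"
proof -
  define C where "C j = (-1) ^ j * fdet m (\<lambda>a b. w (Suc a) (insert_index j b))" for j
  have "fdet (Suc m) (\<lambda>i. if i = 0 then v k else w i) = (\<Sum>j<Suc m. v k j * C j)" for k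
    unfolding fdet_expand_row[OF zero_less_Suc] C_def
    by (intro sum.cong refl) (auto simp: insert_index_def ac_simps)
  then have "(\<Sum>k<Suc n. (-1) ^ k * fdet n (\<lambda>i. v (insert_index k i)) *
           fdet (Suc m) (\<lambda>i. if i = 0 then v k else w i))
     = (\<Sum>k<Suc n. \<Sum>j<Suc m. C j * ((-1) ^ k * fdet n (\<lambda>i. v (insert_index k i)) * v k j))"
    by (auto simp: sum_distrib_left ac_simps simp del: sum.lessThan_Suc)
  also have "\<dots> = (\<Sum>j<Suc m. C j * (\<Sum>k<Suc n. (-1) ^ k * fdet n (\<lambda>i. v (insert_index k i)) * v k j))"
    unfolding sum_distrib_left by (rule sum.swap)
  also have "\<dots> = 0"
    using assms by (intro sum.neutral ballI) (subst sum_minors_eq_0; simp)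
  finally show ?thesis .
qed

lemma fdet_rotate_rows:
  "fdet (Suc m) (\<lambda>i. if i = 0 then f m else f (i - 1)) = (-1) ^ m * fdet (Suc m) f"
  unfolding fdet_expand_row[OF lessI, of m f]
    fdet_expand_row[OF zero_less_Suc, of m "\<lambda>i. if i = 0 then f m else f (i - 1)"] sum_distrib_left
proof (intro sum.cong refl)
  fix j assume "j \<in> {..<Suc m}"
  have "fdet m (\<lambda>a b. (if insert_index 0 a = 0 then f m else f (insert_index 0 a - 1)) (insert_index j b))
      = fdet m (\<lambda>a b. f (insert_index m a) (insert_index j b))"
    by (intro fdet_cong) (auto simp: insert_index_def)
  moreover have "(-1::'a) ^ m * (-1) ^ (m + j) = (-1) ^ j"
    by (simp add: power_add flip: mult.assoc power_mult_distrib)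
  ultimately show "(-1) ^ (0 + j) * (if 0 = 0 then f m else f (0 - 1)) j *
      fdet m (\<lambda>a b. (if insert_index 0 a = 0 then f m else f (insert_index 0 a - 1)) (insert_index j b))
    = (-1) ^ m * ((-1) ^ (m + j) * f m j * fdet m (\<lambda>a b. f (insert_index m a) (insert_index j b)))"
    by (simp add: mult.assoc[symmetric])
qed

section \<open>The identity for an abstract shift\<close>

text \<open>Here \<open>y i j\<close> stands for \<open>\<Delta>^i x_(2j+1)\<close>, and the
  assumptions on \<open>y\<close> are all that is needed to know about the
  \<open>x_k\<close>.\<close>

lemma casoratian_identity:
  fixes y :: "nat \<Rightarrow> nat \<Rightarrow> 'a::comm_ring_1"
  assumes "comm_ring_hom E"
    and E_y: "\<And>i j. E (y i j) = y i j + y (Suc i) j"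
    and y_1_0: "y 1 0 = 1" and y_0: "\<And>i. y (Suc (Suc i)) 0 = 0"
    and y_Suc: "\<And>i j. y (Suc (Suc i)) (Suc j) = y i j"
  defines "W \<equiv> \<lambda>n. fdet n y"
  shows "E (W (Suc (Suc m))) * W m - W (Suc (Suc m)) * E (W m) = W (Suc m) * E (W (Suc m))"
proof -
  interpret comm_ring_hom E by fact
  \<comment> \<open>Column 0 of the rows \<Delta>, \<Delta>^2, ... is (1, 0, 0, ...); what is left
    after deleting it is \<open>y\<close> itself, by \<open>y_Suc\<close>.\<close>
  have W_up: "fdet (Suc n) (\<lambda>i. y (Suc i)) = W n" for n
  proof -
    have "fdet (Suc n) (\<lambda>i. y (Suc i)) = (\<Sum>i<Suc n. if i = 0 then W n else 0)"
      unfolding fdet_expand_column[OF zero_less_Suc] W_def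
    proof (intro sum.cong refl)
      fix i assume "i \<in> {..<Suc n}"
      show "(-1) ^ (i + 0) * y (Suc i) 0 * fdet n (\<lambda>a b. y (Suc (insert_index i a)) (insert_index 0 b))
        = (if i = 0 then fdet n y else 0)"
        by (cases i) (use y_1_0 in \<open>simp_all add: insert_index_def y_0 y_Suc\<close>)
    qed
    then show ?thesis by simp
  qed
  \<comment> \<open>Since E \<Delta>^i = \<Delta>^(i+1) + \<Delta>^i, the rows \<Delta>, E \<Delta>,
    E \<Delta>^2, ... arise from those of \<open>W_up\<close> by adding to each its
    predecessor.\<close>
  have W_up': "fdet (Suc n) (\<lambda>i. if i = 0 then y 1 else (\<lambda>j. E (y i j))) = W n" for n
  proof -
    have "fdet (Suc n) (\<lambda>i. if i = 0 then y 1 else (\<lambda>j. E (y i j)))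
      = fdet (Suc n) (\<lambda>i j. y (Suc i) j + (if i = 0 then 0 else 1) * y (Suc (i - 1)) j)"
      by (intro fdet_cong) (auto simp: E_y)
    then show ?thesis
      using fdet_add_previous_rows[of "\<lambda>i. if i = 0 then 0 else 1" "Suc n" "\<lambda>i. y (Suc i)"]
      by (simp add: W_up)
  qed
  txt \<open>With \<open>y i = \<Delta>\<^sup>i (y 0)\<close>, the rows \<open>v 0, v 1, \<dots>\<close> are \<open>E, \<Delta>, E \<Delta>, E \<Delta>\<^sup>2, \<dots>\<close> applied to \<open>y 0\<close>.\<close>
  define v where "v k = (if k = 1 then y 1 else (\<lambda>j. E (y (k - 1) j)))" for k
  define w where "w i = (\<lambda>j. E (y i j))" for i
  define D where "D k = fdet (Suc (Suc m)) (\<lambda>i. v (insert_index k i))" for k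
  define P where "P k = fdet (Suc m) (\<lambda>i. if i = 0 then v k else w i)" for k
  have D0: "D 0 = W (Suc m)"
    unfolding D_def W_up'[symmetric]
    by (intro fdet_cong) (auto simp: v_def insert_index_def)
  have D1: "D 1 = E (W (Suc (Suc m)))"
    unfolding D_def W_def hom_fdet
    by (intro fdet_cong) (auto simp: v_def insert_index_def)
  have D2: "D (Suc (Suc m)) = W (Suc (Suc m))"
  proof -
    let ?n = "Suc (Suc m)"
    \<comment> \<open>The rows of \<open>?g\<close> are 1, \<Delta>, E \<Delta>, ..., E \<Delta>^m;
      adding row 1 to row 0 turns 1 into E = 1 + \<Delta>.\<close>
    let ?g = "\<lambda>i j. y i j + (if i \<le> 1 then 0 else 1) * y (i - 1) j"
    have "D ?n = fdet ?n (\<lambda>i j. if i = 0 then ?g 1 j + ?g i j else ?g i j)"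
      unfolding D_def
      by (intro fdet_cong) (auto simp: v_def insert_index_def E_y not_le split: nat.splits)
    also have "\<dots> = fdet ?n ?g"
      by (rule fdet_add_row) auto
    also have "\<dots> = W ?n"
      unfolding W_def by (rule fdet_add_previous_rows) auto
    finally show ?thesis .
  qed
  have P0: "P 0 = E (W (Suc m))"
    unfolding P_def W_def hom_fdet
    by (intro fdet_cong) (auto simp: v_def w_def)
  have P1: "P 1 = W m"
    unfolding P_def W_up'[symmetric]
    by (intro fdet_cong) (auto simp: v_def w_def)
  have P2: "P (Suc (Suc m)) = (-1) ^ m * E (W m)"
  proof -
    have "P (Suc (Suc m)) = fdet (Suc m) (\<lambda>i. if i = 0 then w (Suc m) else w (Suc (i - 1)))"
      unfolding P_def by (intro fdet_cong) (auto simp: v_def w_def)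
    then show ?thesis
      unfolding fdet_rotate_rows[of m "\<lambda>i. w (Suc i)"]
      by (simp add: w_def W_up[symmetric] hom_fdet)
  qed
  \<comment> \<open>Here \<open>v (k + 2)\<close> equals \<open>w (k + 1)\<close>, so a row repeats.
    Only three terms of the Pluecker sum survive, and the sign of the rotation in \<open>P2\<close>
    cancels that of the last one.\<close>
  have P_eq_0: "P (Suc (Suc k)) = 0" if "k < m" for k
    unfolding P_def using that
    by (intro fdet_equal_rows[of 0 "Suc k"]) (auto simp: v_def w_def)
  have "(\<Sum>k<Suc (Suc (Suc m)). (-1) ^ k * D k * P k) = 0"
    unfolding D_def P_def by (rule pluecker) simp
  moreover have split_sum: "(\<Sum>k<Suc (Suc (Suc m)). g k)
      = g 0 + g 1 + (\<Sum>k<m. g (Suc (Suc k))) + g (Suc (Suc m))" for g :: "nat \<Rightarrow> 'a"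
    by (subst sum.lessThan_Suc) (simp add: sum.lessThan_Suc_shift add.assoc del: sum.lessThan_Suc)
  ultimately have "D 0 * P 0 - D 1 * P 1 + (\<Sum>k<m. (-1) ^ k * D (Suc (Suc k)) * P (Suc (Suc k)))
     + (-1) ^ m * D (Suc (Suc m)) * P (Suc (Suc m)) = 0"
    unfolding split_sum by simp
  then show ?thesis
    unfolding D0 D1 D2 P0 P1 P2
    by (simp add: P_eq_0 algebra_simps flip: power_mult_distrib)
qed


section \<open>Hessenberg determinants and the recurrence for \<open>x_poly\<close>\<close>

definition hessenberg :: "(nat \<Rightarrow> 'a) \<Rightarrow> nat \<Rightarrow> nat \<Rightarrow> 'a::comm_ring_1" where
  "hessenberg z i j = (if j \<le> i then z (i - j + 1) else if j = i + 1 then - of_nat (i + 1) else 0)"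

text \<open>Deleting the last row and column \<open>j\<close> leaves a block lower triangular
  matrix: the leading block of size \<open>j\<close>, then a triangular block with diagonal -(j+1),
  ..., -n. These signs cancel those of the Laplace expansion.\<close>

lemma fdet_hessenberg:
  fixes z :: "nat \<Rightarrow> 'a::idom"
  shows "fdet (Suc n) (hessenberg z)
    = (\<Sum>j<Suc n. z (n - j + 1) * (\<Prod>i = j..<n. of_nat (Suc i)) * fdet j (hessenberg z))"
proof -
  have "fdet n (\<lambda>a b. hessenberg z (insert_index n a) (insert_index j b))
      = fdet j (hessenberg z) * (\<Prod>i = j..<n. - of_nat (Suc i))" if "j \<le> n" for j
  proof -
    define C where "C = mat (n - j) j (\<lambda>(a, b). hessenberg z (a + j) b)"
    define D where "D = mat (n - j) (n - j) (\<lambda>(a, b). hessenberg z (a + j) (Suc (b + j)))"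
    have "mat n n (\<lambda>(a, b). hessenberg z (insert_index n a) (insert_index j b))
        = four_block_mat (mat j j (\<lambda>(a, b). hessenberg z a b)) (0\<^sub>m j (n - j)) C D"
      using that by (intro eq_matI) (auto simp: C_def D_def insert_index_def hessenberg_def)
    then have "fdet n (\<lambda>a b. hessenberg z (insert_index n a) (insert_index j b)) = fdet j (hessenberg z) * det D"
      unfolding fdet_def by (simp add: det_four_block_mat_upper_right_zero[of _ j _ "n - j"] C_def D_def)
    also have "det D = (\<Prod>i = 0..<n - j. - of_nat (Suc (i + j)))"
      by (subst det_lower_triangular[of "n - j"])
        (auto simp: D_def hessenberg_def prod_list_diag_prod intro!: prod.cong)
    also have "\<dots> = (\<Prod>i = j..<n. - of_nat (Suc i))"
      using prod.shift_bounds_nat_ivl[of "\<lambda>i. - of_nat (Suc i) :: 'a" 0 j "n - j"] that by simp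
    finally show ?thesis .
  qed
  moreover have "(\<Prod>i = j..<n. - of_nat (Suc i) :: 'a) = (-1) ^ (n + j) * (\<Prod>i = j..<n. of_nat (Suc i))"
    if "j \<le> n" for j
    using that by (subst prod_uminus) (simp add: minus_one_power_iff)
  ultimately show ?thesis
    unfolding fdet_expand_row[OF lessI]
    by (auto simp: hessenberg_def mult.assoc[symmetric] simp flip: power_mult_distrib
        simp del: sum.lessThan_Suc intro!: sum.cong)
qed


lemma smult_const_inverse:
  assumes "k > 0"
  shows "smult (const (1 / of_nat k)) (of_nat k * p) = p"
proof -
  have "const (1 / of_nat k) * of_nat k = const (1 / of_nat k) * Poly_Mapping.single 0 (of_nat k)"
    by simp
  also have "\<dots> = 1"
    unfolding const_def mult_single using assms by simp
  finally show ?thesis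
    by (simp add: of_nat_poly)
qed

lemma fact_mult_x_poly: "of_nat (fact n) * x_poly (int n) = fdet n (hessenberg zi)"
proof -
  have "det (x_mat n) = fdet n (hessenberg zi)"
    unfolding fdet_def x_mat_def hessenberg_def ..
  then have "x_poly (int n) = smult (const (1 / of_nat (fact n))) (fdet n (hessenberg zi))"
    using smult_const_inverse[of 1 1] by (cases "n = 0") (simp_all add: x_poly_def)
  then have "of_nat (fact n) * x_poly (int n)
      = smult (const (1 / of_nat (fact n))) (of_nat (fact n) * fdet n (hessenberg zi))"
    by (simp only: mult_smult_right)
  then show ?thesis
    by (simp only: smult_const_inverse fact_gt_zero)
qed

text \<open>This is the logarithmic derivative of the generating function, read off coefficientwise.
  It follows from \<open>fdet_hessenberg\<close> by cancelling \<open>fact n\<close>.\<close>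

lemma x_poly_recurrence:
  "of_nat (Suc n) * x_poly (int (Suc n)) = (\<Sum>j<Suc n. zi (n - j + 1) * x_poly (int j))"
proof -
  have prod_fact: "(\<Prod>i = j..<n. of_nat (Suc i)) * of_nat (fact j) = (of_nat (fact n) :: params poly)"
    if "j \<le> n" for j
    using that
  proof (induction rule: dec_induct)
    case (step k)
    have "(\<Prod>i = j..<Suc k. of_nat (Suc i)) * of_nat (fact j)
        = (of_nat (Suc k) * ((\<Prod>i = j..<k. of_nat (Suc i)) * of_nat (fact j)) :: params poly)"
      using step.hyps by (simp add: mult_ac del: of_nat_Suc)
    also have "\<dots> = of_nat (fact (Suc k))"
      by (simp only: step.IH fact_Suc of_nat_mult of_nat_id)
    finally show ?case .
  qed simp
  have "of_nat (fact n) * (of_nat (Suc n) * x_poly (int (Suc n)))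
      = of_nat (fact (Suc n)) * x_poly (int (Suc n))"
    by (simp add: algebra_simps)
  also have "\<dots> = (\<Sum>j<Suc n. zi (n - j + 1) * (\<Prod>i = j..<n. of_nat (Suc i))
      * (of_nat (fact j) * x_poly (int j)))"
    unfolding fact_mult_x_poly fdet_hessenberg ..
  also have "\<dots> = (\<Sum>j<Suc n. of_nat (fact n) * (zi (n - j + 1) * x_poly (int j)))"
  proof (intro sum.cong refl)
    fix j assume "j \<in> {..<Suc n}"
    then have "j \<le> n" by simp
    show "zi (n - j + 1) * (\<Prod>i = j..<n. of_nat (Suc i)) * (of_nat (fact j) * x_poly (int j))
        = of_nat (fact n) * (zi (n - j + 1) * x_poly (int j))"
      unfolding prod_fact[OF \<open>j \<le> n\<close>, symmetric] by (simp only: mult_ac)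
  qed
  finally show ?thesis
    unfolding sum_distrib_left[symmetric] by simp
qed

section \<open>The shift and the final identity\<close>

interpretation shift: comm_ring_hom shift
  by unfold_locales (simp_all add: shift_def pcompose_add pcompose_mult one_pCons)

lemma shift_zi: "shift (zi i) = zi i + (-1) ^ (i + 1)"
proof -
  have "shift ([:0, 1:] + [:t_var i:]) = [:0, 1:] + [:t_var i:] + 1"
    by (simp add: shift_def pcompose_pCons one_pCons)
  moreover have "shift ((-1) ^ (i + 1)) = (-1) ^ (i + 1)"
    by (simp add: hom_distribs)
  ultimately show ?thesis
    unfolding zi_def shift.hom_mult by (simp only: distrib_left mult_1_right)
qed

text \<open>Shifting the recurrence for n = m + 1 and using the induction hypothesis splits the
  right side into n x_n, m x_m and an alternating sum that telescopes to x_m. The total is n (x_n +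
  x_m), and n cancels.\<close>

lemma shift_x_poly_nat: "shift (x_poly (int n)) = x_poly (int n) + x_poly (int n - 1)"
proof (induction n rule: less_induct)
  case (less n)
  show ?case
  proof (cases n)
    case 0
    then show ?thesis by (simp add: x_poly_def)
  next
    case (Suc m)
    have telescope: "(\<Sum>j<Suc k. (-1) ^ (k - j) * (x_poly (int j) + x_poly (int j - 1))) = x_poly (int k)" for k
    proof (induction k)
      case 0
      then show ?case by (simp add: x_poly_def)
    next
      case (Suc k)
      have "(\<Sum>j<Suc k. (-1) ^ (Suc k - j) * (x_poly (int j) + x_poly (int j - 1)))
          = - (\<Sum>j<Suc k. (-1) ^ (k - j) * (x_poly (int j) + x_poly (int j - 1)))"
        unfolding sum_negf[symmetric] by (intro sum.cong) (auto simp: Suc_diff_le)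
      then show ?case
        unfolding Suc.IH by (subst sum.lessThan_Suc) (simp del: sum.lessThan_Suc)
    qed
    \<comment> \<open>The term j = 0 vanishes because x_(-1) = 0; the others form the recurrence for
      x_m.\<close>
    have prev: "(\<Sum>j<Suc m. zi (m - j + 1) * x_poly (int j - 1)) = of_nat m * x_poly (int m)"
    proof (cases m)
      case (Suc l)
      then show ?thesis
        unfolding sum.lessThan_Suc_shift
        by (simp only: x_poly_recurrence)
          (simp add: x_poly_def Suc_diff_le sum.lessThan_Suc_shift del: sum.lessThan_Suc)
    qed (simp add: x_poly_def)
    have "of_nat n * shift (x_poly (int n)) = shift (of_nat n * x_poly (int n))"
      by (simp add: hom_distribs)
    also have "\<dots> = (\<Sum>j<Suc m. shift (zi (m - j + 1)) * shift (x_poly (int j)))"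
      unfolding Suc x_poly_recurrence by (simp only: hom_distribs)
    also have "\<dots> = (\<Sum>j<Suc m. zi (m - j + 1) * x_poly (int j) + zi (m - j + 1) * x_poly (int j - 1)
        + (-1) ^ (m - j) * (x_poly (int j) + x_poly (int j - 1)))"
      by (intro sum.cong refl) (simp add: shift_zi less Suc algebra_simps)
    also have "\<dots> = of_nat n * x_poly (int n) + of_nat m * x_poly (int m) + x_poly (int m)"
      unfolding sum.distrib telescope prev Suc x_poly_recurrence ..
    also have "\<dots> = of_nat n * (x_poly (int n) + x_poly (int n - 1))"
      unfolding Suc by (simp add: algebra_simps)
    finally show ?thesis
      using Suc by (simp del: of_nat_Suc)
  qed
qed

lemma shift_x_poly: "shift (x_poly k) = x_poly k + x_poly (k - 1)"
  by (cases k) (simp_all only: shift_x_poly_nat, simp add: x_poly_def)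

lemma Q_poly_eq_fdet: "Q_poly (int n) = fdet n (\<lambda>i j. x_poly (2 * int j + 1 - int i))"
  by (cases "n = 0") (simp_all add: Q_poly_def fdet_def algebra_simps)

theorem theorem2:
  fixes n :: nat
  shows "shift (Q_poly (int n + 1)) * Q_poly (int n - 1) - Q_poly (int n + 1) * shift (Q_poly (int n - 1))
           = Q_poly (int n) * shift (Q_poly (int n))"
proof (cases n)
  case 0
  \<comment> \<open>The index -1 is outside the reach of \<open>Q_poly_eq_fdet\<close>. With Q_(-1)
    = Q_0 = 1 the claim reduces to \<Delta> x_1 = 1.\<close>
  have "Q_poly 1 = x_poly 1"
    by (simp add: Q_poly_def det_single[where A = "mat (Suc 0) (Suc 0) _"])
  then show ?thesis
    using 0 by (simp add: shift_x_poly) (simp add: Q_poly_def x_poly_def)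
next
  case (Suc m)
  let ?y = "\<lambda>i j. x_poly (2 * int j + 1 - int i)"
  have "shift (fdet (Suc (Suc m)) ?y) * fdet m ?y - fdet (Suc (Suc m)) ?y * shift (fdet m ?y)
      = fdet (Suc m) ?y * shift (fdet (Suc m) ?y)"
  proof (rule casoratian_identity)
    show "comm_ring_hom shift" ..
    show "shift (?y i j) = ?y i j + ?y (Suc i) j" for i j
      unfolding shift_x_poly by (simp add: algebra_simps)
  qed (simp_all add: x_poly_def algebra_simps)
  moreover have "int n + 1 = int (Suc (Suc m))" "int n - 1 = int m"
    using Suc by simp_all
  ultimately show ?thesis
    unfolding Suc by (simp only: Q_poly_eq_fdet)
qed

end
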